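(* Let $A\to M$ be a vector bundle, let $\circ$ be a local Leibniz product on the space $\mathcal{A}=Sec(A)$ of its sections, and let $N:A\to A$ be a $(1,1)$-tensor. Then the contracted product $$X\circ_N Y=N(X)\circ Y+X\circ N(Y)-N(X\circ Y)$$ is a Leibniz product if and only if the Nijenhuis torsion $T_N(X,Y)=N(X)\circ N(Y)-N(X\circ_N Y)$ is a 2-cocycle with respect to the Leibniz cohomology operator, i.e. $$(\delta T_N)(X,Y,Z)=T_N(X,Y\circ Z)-T_N(X\circ Y,Z)-T_N(Y,X\circ Z)-T_N(X,Y)\circ Z+X\circ T_N(Y,Z)-Y\circ T_N(X,Z)=0$$ for all $X,Y,Z\in\mathcal{A}$. In this case $\circ_N$ and $\circ$ are compatible Leibniz products.
   Context: A Leibniz product on a (real) vector space $\mathcal{A}$ is a bilinear operation $\circ$ satisfying $(X\circ Y)\circ Z=X\circ(Y\circ Z)-Y\circ(X\circ Z)$ for all $X,Y,Z\in\mathcal{A}$ (no skew-symmetry is required). A product on $Sec(A)$ is local if it is locally defined by a bidifferential operator. A $(1,1)$-tensor over $A$ is a vector bundle morphism $N:A\to A$ over the identity of $M$, equivalently a $C^\infty(M)$-linear map $N:Sec(A)\to Sec(A)$. Two Leibniz products $\circ_N$ and $\circ$ are called compatible if $(X,Y)\mapsto X\circ_N Y+\lambda\, X\circ Y$ is a Leibniz product for every $\lambda\in\mathbb{R}$. *)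

theory Defs
  imports "HOL-Analysis.Analysis"
begin

text \<open>
  Coordinates live in the library's \<open>Euclidean_space n\<close>, the space of sequences
  \<open>nat \<Rightarrow> real\<close> vanishing from index \<open>n\<close> on.  In this way dimensions and ranks are natural
  numbers, and \<open>0\<close> is allowed for both.
\<close>

definition partial_deriv :: "nat \<Rightarrow> ((nat \<Rightarrow> real) \<Rightarrow> real) \<Rightarrow> (nat \<Rightarrow> real) \<Rightarrow> real" where
  "partial_deriv i f = (\<lambda>z. deriv (\<lambda>t. f (z(i := t))) (z i))"

primrec iter_partial :: "nat list \<Rightarrow> ((nat \<Rightarrow> real) \<Rightarrow> real) \<Rightarrow> (nat \<Rightarrow> real) \<Rightarrow> real" where
  "iter_partial [] f = f"
| "iter_partial (i # is) f = partial_deriv i (iter_partial is f)"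

text \<open>The class $C^\infty$: all iterated partial derivatives exist and are continuous.\<close>

definition smooth_fun_on :: "nat \<Rightarrow> (nat \<Rightarrow> real) set \<Rightarrow> ((nat \<Rightarrow> real) \<Rightarrow> real) \<Rightarrow> bool" where
  "smooth_fun_on n S f \<longleftrightarrow>
     openin (Euclidean_space n) S \<and>
     (\<forall>is. set is \<subseteq> {..<n} \<longrightarrow>
        continuous_map (subtopology (Euclidean_space n) S) euclideanreal (iter_partial is f) \<and>
        (\<forall>i<n. \<forall>z\<in>S. (\<lambda>t. iter_partial is f (z(i := t))) field_differentiable (at (z i))))"

text \<open>
  A chart is a pair of its domain and its coordinate map; only the values of the coordinate map
  on the domain matter.
\<close>

type_synonym 'm chart = "'m set \<times> ('m \<Rightarrow> nat \<Rightarrow> real)"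

text \<open>
  The openness of the coordinate domain is required explicitly (also for \<open>m = 0\<close>).  Demanded for
  all pairs of charts it says that \<open>F\<close> is continuous.
\<close>

definition smooth_map ::
  "nat \<Rightarrow> 'm chart set \<Rightarrow> nat \<Rightarrow> 'k chart set \<Rightarrow> ('m \<Rightarrow> 'k) \<Rightarrow> bool" where
  "smooth_map n atl m atl' F \<longleftrightarrow>
     (\<forall>(U, x)\<in>atl. \<forall>(V, y)\<in>atl'.
        openin (Euclidean_space n) (x ` (U \<inter> F -` V)) \<and>
        (\<forall>j<m. smooth_fun_on n (x ` (U \<inter> F -` V)) (\<lambda>z. y (F (inv_into U x z)) j)))"

text \<open>
  A smooth structure of dimension \<open>n\<close> on a Hausdorff, second countable space.  Smoothness of the
  identity is smooth compatibility of all pairs of charts.  The atlas need not be maximal.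
\<close>

definition smooth_atlas ::
  "nat \<Rightarrow> ('m::{t2_space,second_countable_topology}) chart set \<Rightarrow> bool" where
  "smooth_atlas n atl \<longleftrightarrow>
     (\<Union>(U, x)\<in>atl. U) = UNIV \<and>
     (\<forall>(U, x)\<in>atl.
        open U \<and> openin (Euclidean_space n) (x ` U) \<and>
        homeomorphic_map (top_of_set U) (subtopology (Euclidean_space n) (x ` U)) x) \<and>
     smooth_map n atl n atl id"

record ('m, 'a) vbundle =
  bdim :: nat
  brank :: nat
  batlas :: "'m chart set"
  btrivs :: "'a chart set"
  bproj :: "'a \<Rightarrow> 'm"
  badd :: "'a \<Rightarrow> 'a \<Rightarrow> 'a"
  bscale :: "real \<Rightarrow> 'a \<Rightarrow> 'a"
  bzero :: "'m \<Rightarrow> 'a"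

text \<open>
  The base manifold is the type \<open>'m\<close>, the total space is the type \<open>'a\<close>.  A local
  trivialization over an open set \<open>V\<close> of the base is given by the pair of \<open>\<pi>\<^sup>-\<^sup>1(V)\<close> and of the
  second component \<open>\<phi>\<close> of the trivialization \<open>(\<pi>, \<phi>) : \<pi>\<^sup>-\<^sup>1(V) \<rightarrow> V \<times> \<real>\<^sup>r\<close>.
\<close>

definition fibre :: "('m, 'a) vbundle \<Rightarrow> 'm \<Rightarrow> 'a set" where
  "fibre A p = bproj A -` {p}"

text \<open>
  The fibred coordinates \<open>(x \<circ> \<pi>, \<phi>)\<close>, taking values in \<open>Euclidean_space (n + r)\<close>, obtained from
  a chart of the base and a local trivialization.
\<close>

definition fibred_coord ::
  "('m, 'a) vbundle \<Rightarrow> ('m \<Rightarrow> nat \<Rightarrow> real) \<Rightarrow> ('a \<Rightarrow> nat \<Rightarrow> real) \<Rightarrow> 'a \<Rightarrow> nat \<Rightarrow> real" where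
  "fibred_coord A x \<phi> e =
     (\<lambda>i. if i < bdim A then x (bproj A e) i else \<phi> e (i - bdim A))"

definition total_atlas :: "('m, 'a) vbundle \<Rightarrow> 'a chart set" where
  "total_atlas A =
     {(bproj A -` U \<inter> P, fibred_coord A x \<phi>) | U x P \<phi>. (U, x) \<in> batlas A \<and> (P, \<phi>) \<in> btrivs A}"

text \<open>
  Linearity of the fibrewise bijections \<open>\<phi>\<close> onto $\mathbb{R}^r$ makes every fibre a real vector
  space of dimension \<open>r\<close>, so that the vector space axioms need not be repeated.  That the fibred
  coordinates form a smooth atlas says that the total space is a smooth manifold on which the local
  trivializations are diffeomorphisms; in particular the projection is smooth.
\<close>

definition smooth_vector_bundle ::
  "('m::{t2_space,second_countable_topology}, 'a::{t2_space,second_countable_topology}) vbundle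
     \<Rightarrow> bool" where
  "smooth_vector_bundle A \<longleftrightarrow>
     smooth_atlas (bdim A) (batlas A) \<and>
     (\<forall>p. bzero A p \<in> fibre A p) \<and>
     (\<forall>p. \<forall>u\<in>fibre A p. \<forall>v\<in>fibre A p. badd A u v \<in> fibre A p) \<and>
     (\<forall>p c. \<forall>u\<in>fibre A p. bscale A c u \<in> fibre A p) \<and>
     (\<Union>(P, \<phi>)\<in>btrivs A. P) = UNIV \<and>
     (\<forall>(P, \<phi>)\<in>btrivs A.
        (\<exists>V. open V \<and> P = bproj A -` V \<and>
          (\<forall>p\<in>V.
             bij_betw \<phi> (fibre A p) (topspace (Euclidean_space (brank A))) \<and>
             \<phi> (bzero A p) = (\<lambda>i. 0) \<and>
             (\<forall>u\<in>fibre A p. \<forall>v\<in>fibre A p. \<phi> (badd A u v) = (\<lambda>i. \<phi> u i + \<phi> v i)) \<and>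
             (\<forall>c. \<forall>u\<in>fibre A p. \<phi> (bscale A c u) = (\<lambda>i. c * \<phi> u i))))) \<and>
     smooth_atlas (bdim A + brank A) (total_atlas A)"

definition sections :: "('m, 'a) vbundle \<Rightarrow> ('m \<Rightarrow> 'a) set" where
  "sections A =
     {X. (\<forall>p. X p \<in> fibre A p) \<and>
         smooth_map (bdim A) (batlas A) (bdim A + brank A) (total_atlas A) X}"

definition sec_add ::
  "('m, 'a) vbundle \<Rightarrow> ('m \<Rightarrow> 'a) \<Rightarrow> ('m \<Rightarrow> 'a) \<Rightarrow> 'm \<Rightarrow> 'a" (infixl "\<oplus>\<index>" 65) where
  "X \<oplus>\<^bsub>A\<^esub> Y = (\<lambda>p. badd A (X p) (Y p))"

definition sec_scale ::
  "('m, 'a) vbundle \<Rightarrow> real \<Rightarrow> ('m \<Rightarrow> 'a) \<Rightarrow> 'm \<Rightarrow> 'a" (infixr "\<odot>\<index>" 75) where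
  "c \<odot>\<^bsub>A\<^esub> X = (\<lambda>p. bscale A c (X p))"

definition sec_diff ::
  "('m, 'a) vbundle \<Rightarrow> ('m \<Rightarrow> 'a) \<Rightarrow> ('m \<Rightarrow> 'a) \<Rightarrow> 'm \<Rightarrow> 'a" (infixl "\<ominus>\<index>" 65) where
  "X \<ominus>\<^bsub>A\<^esub> Y = X \<oplus>\<^bsub>A\<^esub> ((- 1) \<odot>\<^bsub>A\<^esub> Y)"

definition sec_zero :: "('m, 'a) vbundle \<Rightarrow> 'm \<Rightarrow> 'a" where
  "sec_zero A = bzero A"

text \<open>
  A (1,1)-tensor: a smooth vector bundle morphism over the identity of the base.  It acts on
  sections by composition, \<open>N(X) = N \<circ> X\<close>.
\<close>

definition bundle_endomorphism :: "('m, 'a) vbundle \<Rightarrow> ('a \<Rightarrow> 'a) \<Rightarrow> bool" where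
  "bundle_endomorphism A N \<longleftrightarrow>
     (\<forall>e. bproj A (N e) = bproj A e) \<and>
     (\<forall>p. \<forall>u\<in>fibre A p. \<forall>v\<in>fibre A p. N (badd A u v) = badd A (N u) (N v)) \<and>
     (\<forall>p c. \<forall>u\<in>fibre A p. N (bscale A c u) = bscale A c (N u)) \<and>
     smooth_map (bdim A + brank A) (total_atlas A) (bdim A + brank A) (total_atlas A) N"

definition bilinear_product ::
  "('m, 'a) vbundle \<Rightarrow> (('m \<Rightarrow> 'a) \<Rightarrow> ('m \<Rightarrow> 'a) \<Rightarrow> 'm \<Rightarrow> 'a) \<Rightarrow> bool" where
  "bilinear_product A prd \<longleftrightarrow>
     (\<forall>X\<in>sections A. \<forall>Y\<in>sections A. X \<star> Y \<in> sections A) \<and>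
     (\<forall>X\<in>sections A. \<forall>Y\<in>sections A. \<forall>Z\<in>sections A.
        (X \<oplus> Y) \<star> Z = (X \<star> Z) \<oplus> (Y \<star> Z) \<and> X \<star> (Y \<oplus> Z) = (X \<star> Y) \<oplus> (X \<star> Z)) \<and>
     (\<forall>c. \<forall>X\<in>sections A. \<forall>Y\<in>sections A.
        (c \<odot> X) \<star> Y = c \<odot> (X \<star> Y) \<and> X \<star> (c \<odot> Y) = c \<odot> (X \<star> Y))"
  for A (structure) and prd (infixl "\<star>" 70)

definition leibniz_product ::
  "('m, 'a) vbundle \<Rightarrow> (('m \<Rightarrow> 'a) \<Rightarrow> ('m \<Rightarrow> 'a) \<Rightarrow> 'm \<Rightarrow> 'a) \<Rightarrow> bool" where
  "leibniz_product A prd \<longleftrightarrow>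
     bilinear_product A prd \<and>
     (\<forall>X\<in>sections A. \<forall>Y\<in>sections A. \<forall>Z\<in>sections A.
        (X \<star> Y) \<star> Z = (X \<star> (Y \<star> Z)) \<ominus> (Y \<star> (X \<star> Z)))"
  for A (structure) and prd (infixl "\<star>" 70)

definition compatible_leibniz_products ::
  "('m, 'a) vbundle \<Rightarrow> (('m \<Rightarrow> 'a) \<Rightarrow> ('m \<Rightarrow> 'a) \<Rightarrow> 'm \<Rightarrow> 'a) \<Rightarrow>
     (('m \<Rightarrow> 'a) \<Rightarrow> ('m \<Rightarrow> 'a) \<Rightarrow> 'm \<Rightarrow> 'a) \<Rightarrow> bool" where
  "compatible_leibniz_products A prd1 prd2 \<longleftrightarrow>
     leibniz_product A prd1 \<and> leibniz_product A prd2 \<and>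
     (\<forall>c::real. leibniz_product A (\<lambda>X Y. prd1 X Y \<oplus> (c \<odot> prd2 X Y)))"
  for A (structure)

text \<open>
  Locality: around every point, in coordinates \<open>x\<close> of the base and in a local frame, the product
  is \<open>(X \<star> Y)\<^sup>l = \<Sum> c(\<alpha>,\<beta>,i,j,l) \<cdot> \<partial>\<^sub>\<alpha>X\<^sup>i \<cdot> \<partial>\<^sub>\<beta>Y\<^sup>j\<close> with smooth coefficients, the sum
  being over bounded orders of differentiation.  Multi-indices are written as lists of coordinate
  indices; different lists may denote the same derivative, which does not change the class of
  operators.
\<close>

definition multi_indices :: "nat \<Rightarrow> nat \<Rightarrow> nat list set" where
  "multi_indices n k = {\<alpha>. set \<alpha> \<subseteq> {..<n} \<and> length \<alpha> \<le> k}"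

definition local_comp ::
  "'m chart \<Rightarrow> ('a \<Rightarrow> nat \<Rightarrow> real) \<Rightarrow> ('m \<Rightarrow> 'a) \<Rightarrow> nat \<Rightarrow> (nat \<Rightarrow> real) \<Rightarrow> real" where
  "local_comp ch \<phi> X i = (\<lambda>z. \<phi> (X (inv_into (fst ch) (snd ch) z)) i)"

definition local_product ::
  "('m::topological_space, 'a) vbundle \<Rightarrow> (('m \<Rightarrow> 'a) \<Rightarrow> ('m \<Rightarrow> 'a) \<Rightarrow> 'm \<Rightarrow> 'a) \<Rightarrow> bool" where
  "local_product A prd \<longleftrightarrow>
     (\<forall>q. \<exists>(U, x)\<in>batlas A. \<exists>(P, \<phi>)\<in>btrivs A. \<exists>W.
        open W \<and> q \<in> W \<and> W \<subseteq> U \<and> bproj A -` W \<subseteq> P \<and>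
        (\<exists>k c.
           (\<forall>\<alpha>\<in>multi_indices (bdim A) k. \<forall>\<beta>\<in>multi_indices (bdim A) k.
              \<forall>i<brank A. \<forall>j<brank A. \<forall>l<brank A.
                smooth_fun_on (bdim A) (x ` W) (c \<alpha> \<beta> i j l)) \<and>
           (\<forall>X\<in>sections A. \<forall>Y\<in>sections A. \<forall>p\<in>W. \<forall>l<brank A.
              \<phi> (prd X Y p) l =
                (\<Sum>\<alpha>\<in>multi_indices (bdim A) k. \<Sum>\<beta>\<in>multi_indices (bdim A) k.
                 \<Sum>i<brank A. \<Sum>j<brank A.
                   c \<alpha> \<beta> i j l (x p) *
                   iter_partial \<alpha> (local_comp (U, x) \<phi> X i) (x p) *
                   iter_partial \<beta> (local_comp (U, x) \<phi> Y j) (x p)))))"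

definition contracted_product ::
  "('m, 'a) vbundle \<Rightarrow> ('a \<Rightarrow> 'a) \<Rightarrow> (('m \<Rightarrow> 'a) \<Rightarrow> ('m \<Rightarrow> 'a) \<Rightarrow> 'm \<Rightarrow> 'a) \<Rightarrow>
     ('m \<Rightarrow> 'a) \<Rightarrow> ('m \<Rightarrow> 'a) \<Rightarrow> 'm \<Rightarrow> 'a" where
  "contracted_product A N prd X Y =
     (((N \<circ> X) \<star> Y) \<oplus> (X \<star> (N \<circ> Y))) \<ominus> (N \<circ> (X \<star> Y))"
  for A (structure) and N and prd (infixl "\<star>" 70)

definition nijenhuis_torsion ::
  "('m, 'a) vbundle \<Rightarrow> ('a \<Rightarrow> 'a) \<Rightarrow> (('m \<Rightarrow> 'a) \<Rightarrow> ('m \<Rightarrow> 'a) \<Rightarrow> 'm \<Rightarrow> 'a) \<Rightarrow>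
     ('m \<Rightarrow> 'a) \<Rightarrow> ('m \<Rightarrow> 'a) \<Rightarrow> 'm \<Rightarrow> 'a" where
  "nijenhuis_torsion A N prd X Y =
     ((N \<circ> X) \<star> (N \<circ> Y)) \<ominus> (N \<circ> contracted_product A N prd X Y)"
  for A (structure) and N and prd (infixl "\<star>" 70)

definition leibniz_delta ::
  "('m, 'a) vbundle \<Rightarrow> (('m \<Rightarrow> 'a) \<Rightarrow> ('m \<Rightarrow> 'a) \<Rightarrow> 'm \<Rightarrow> 'a) \<Rightarrow>
     (('m \<Rightarrow> 'a) \<Rightarrow> ('m \<Rightarrow> 'a) \<Rightarrow> 'm \<Rightarrow> 'a) \<Rightarrow>
     ('m \<Rightarrow> 'a) \<Rightarrow> ('m \<Rightarrow> 'a) \<Rightarrow> ('m \<Rightarrow> 'a) \<Rightarrow> 'm \<Rightarrow> 'a" where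
  "leibniz_delta A prd T X Y Z =
     T X (Y \<star> Z) \<ominus> T (X \<star> Y) Z \<ominus> T Y (X \<star> Z)
       \<ominus> (T X Y \<star> Z) \<oplus> (X \<star> T Y Z) \<ominus> (Y \<star> T X Z)"
  for A (structure) and prd (infixl "\<star>" 70) and T

definition leibniz_2_cocycle ::
  "('m, 'a) vbundle \<Rightarrow> (('m \<Rightarrow> 'a) \<Rightarrow> ('m \<Rightarrow> 'a) \<Rightarrow> 'm \<Rightarrow> 'a) \<Rightarrow>
     (('m \<Rightarrow> 'a) \<Rightarrow> ('m \<Rightarrow> 'a) \<Rightarrow> 'm \<Rightarrow> 'a) \<Rightarrow> bool" where
  "leibniz_2_cocycle A prd T \<longleftrightarrow>
     (\<forall>X\<in>sections A. \<forall>Y\<in>sections A. \<forall>Z\<in>sections A.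
        leibniz_delta A prd T X Y Z = sec_zero A)"

end

theory Submission
  imports Defs
begin

text \<open>
  Write \<open>\<star>\<close> for the given product and \<open>\<star>\<^sub>N\<close> for the contracted one. The theorem rests on an
  algebraic identity: the coboundary $\delta T_N(X,Y,Z)$ equals the Leibniz defect
  $(X \star_N Y) \star_N Z - X \star_N (Y \star_N Z) + Y \star_N (X \star_N Z)$
  (\<open>delta_torsion_eq_leibniz_defect\<close>). To see it, expand the defect and write
  $N(X \star_N Y) = N X \star N Y - T_N(X,Y)$ and
  $N(X \star Y) \star N Z = T_N(X \star Y, Z) + N((X \star Y) \star_N Z)$,
  and likewise for the other arguments. The terms with a torsion add up to $\delta T_N$. The terms
  without an outer $N$ have $N$ on two of the three arguments and cancel by the Leibniz identity of
  \<open>\<star>\<close> for $(NX,NY,Z)$, $(NX,Y,NZ)$ and $(X,NY,NZ)$. The rest is $-N$ of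
  $(X \star_N Y) \star Z + (X \star Y) \star_N Z$ minus the corresponding right-nested terms, which is
  zero (\<open>mixed_leibniz\<close>).
  So one expression vanishes exactly when the other does.

  The product \<open>\<star>\<^sub>N\<close> is itself, up to sign, the coboundary of the 1-cochain \<open>N\<close>. Hence in the Leibniz
  defect of the pencil $\star_N + a\,\star$, the part linear in $a$ is a coboundary of a
  coboundary and vanishes (\<open>mixed_leibniz\<close>), the part of degree two is the defect of \<open>\<star>\<close>, and the
  constant part is the defect of \<open>\<star>\<^sub>N\<close>. Compatibility therefore follows as soon as \<open>\<star>\<^sub>N\<close> is a Leibniz
  product.

  The analytic content is that these expressions are sections at all: smooth sections must be closed
  under addition, scalar multiplication and \<open>X \<mapsto> N \<circ> X\<close>. A map into the total space is a smooth
  section if and only if its components in local trivializations are smooth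
  (\<open>sections_iff_smooth_components\<close>), and fibrewise linearity writes the components of \<open>N \<circ> X\<close> as
  sums of products of components of \<open>X\<close> with matrix entries of \<open>N\<close>. These entries are smooth on
  the base because they are restrictions of the smooth map \<open>N\<close> to slices on which the fibre
  coordinates are constant.
\<close>

section \<open>Smooth functions on open sets of coordinate space\<close>

lemma eventually_fun_upd_in_openin:
  assumes S: "openin (Euclidean_space n) S" and i: "i < n" and z: "z \<in> S"
  shows "\<forall>\<^sub>F t in nhds (z i). z(i := t) \<in> S"
proof -
  have z0: "\<And>j. j \<ge> n \<Longrightarrow> z j = 0"
    using openin_subset[OF S] z by (auto simp: topspace_Euclidean_space)
  have "continuous_map euclideanreal euclideanreal (\<lambda>t. (z(i := t)) j)" for j
    by (cases "j = i") simp_all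
  then have "continuous_map euclideanreal (Euclidean_space n) (\<lambda>t. z(i := t))"
    unfolding Euclidean_space_def continuous_map_in_subtopology continuous_map_componentwise_UNIV
    using z0 i by simp
  then have "open {t. z(i := t) \<in> S}"
    using openin_continuous_map_preimage[OF _ S] by fastforce
  from eventually_nhds_in_open[OF this, of "z i"] show ?thesis
    using z by simp
qed

text \<open>
  Partial derivatives at points of an open set depend only on the values on that set. The functions at
  hand are built from charts and are meaningful only on coordinate domains, so smoothness has to
  be insensitive to their values elsewhere.
\<close>

lemma partial_cong_on_openin:
  assumes S: "openin (Euclidean_space n) S" and i: "i < n" and z: "z \<in> S"
    and eq: "\<And>z. z \<in> S \<Longrightarrow> f z = g z"
  shows partial_deriv_cong_on_openin: "partial_deriv i f z = partial_deriv i g z"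
    and partially_differentiable_cong_on_openin:
      "(\<lambda>t. f (z(i := t))) field_differentiable (at (z i)) \<longleftrightarrow>
       (\<lambda>t. g (z(i := t))) field_differentiable (at (z i))"
proof -
  have ev: "\<forall>\<^sub>F t in nhds (z i). f (z(i := t)) = g (z(i := t))"
    using eventually_fun_upd_in_openin[OF S i z] by (rule eventually_mono) (rule eq)
  show "partial_deriv i f z = partial_deriv i g z"
    unfolding partial_deriv_def by (rule deriv_cong_ev[OF ev refl])
  show "(\<lambda>t. f (z(i := t))) field_differentiable (at (z i)) \<longleftrightarrow>
       (\<lambda>t. g (z(i := t))) field_differentiable (at (z i))"
    unfolding field_differentiable_def DERIV_cong_ev[OF refl ev refl] ..
qed

text \<open>
  Smoothness is the largest property that implies continuity and partial differentiability and passes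
  to partial derivatives. Proving a function smooth thus amounts to placing it in a
  family closed under differentiation, which spares explicit formulas such as the Leibniz rule for
  iterated derivatives of a product.
\<close>

lemma smooth_fun_on_coinduct:
  assumes S: "openin (Euclidean_space n) S" and f: "f \<in> F"
    and cont: "\<And>f. f \<in> F \<Longrightarrow> continuous_map (subtopology (Euclidean_space n) S) euclideanreal f"
    and diff: "\<And>f i z. f \<in> F \<Longrightarrow> i < n \<Longrightarrow> z \<in> S \<Longrightarrow>
                 (\<lambda>t. f (z(i := t))) field_differentiable (at (z i))"
    and step: "\<And>f i. f \<in> F \<Longrightarrow> i < n \<Longrightarrow> \<exists>g\<in>F. \<forall>z\<in>S. partial_deriv i f z = g z"
  shows "smooth_fun_on n S f"
proof -
  have ex: "\<exists>g\<in>F. \<forall>z\<in>S. iter_partial is f z = g z" if "set is \<subseteq> {..<n}" for "is"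
    using that
  proof (induction "is")
    case Nil
    then show ?case using f by auto
  next
    case (Cons i js)
    then obtain g where g: "g \<in> F" "\<forall>z\<in>S. iter_partial js f z = g z" by auto
    obtain h where h: "h \<in> F" "\<forall>z\<in>S. partial_deriv i g z = h z"
      using step[OF g(1), of i] Cons.prems by auto
    have "iter_partial (i # js) f z = h z" if "z \<in> S" for z
      using partial_deriv_cong_on_openin[OF S _ that, of i "iter_partial js f" g] g h that Cons.prems
      by auto
    then show ?case using h by blast
  qed
  show ?thesis
    unfolding smooth_fun_on_def
  proof (intro conjI allI impI ballI)
    fix "is" assume js: "set is \<subseteq> {..<n}"
    obtain g where g: "g \<in> F" "\<forall>z\<in>S. iter_partial is f z = g z" using ex[OF js] by blast
    show "continuous_map (subtopology (Euclidean_space n) S) euclideanreal (iter_partial is f)"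
      by (rule continuous_map_eq[OF cont[OF g(1)]]) (use g in auto)
    fix i z assume "i < n" "z \<in> S"
    then show "(\<lambda>t. iter_partial is f (z(i := t))) field_differentiable (at (z i))"
      using partially_differentiable_cong_on_openin[OF S, of i z "iter_partial is f" g] g diff[of g i z]
      by auto
  qed (rule S)
qed

lemma smooth_fun_on_openin: "smooth_fun_on n S f \<Longrightarrow> openin (Euclidean_space n) S"
  by (simp add: smooth_fun_on_def)

lemma smooth_fun_on_continuous:
  "smooth_fun_on n S f \<Longrightarrow> continuous_map (subtopology (Euclidean_space n) S) euclideanreal f"
  unfolding smooth_fun_on_def by (elim conjE allE[where x = "[]"]) auto

lemma smooth_fun_on_partially_differentiable:
  "smooth_fun_on n S f \<Longrightarrow> i < n \<Longrightarrow> z \<in> S \<Longrightarrow>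
     (\<lambda>t. f (z(i := t))) field_differentiable (at (z i))"
  unfolding smooth_fun_on_def by (elim conjE allE[where x = "[]"]) auto

lemma iter_partial_snoc: "iter_partial (is @ [i]) f = iter_partial is (partial_deriv i f)"
  by (induction "is") auto

lemma smooth_fun_on_partial_deriv:
  assumes "smooth_fun_on n S f" and "i < n"
  shows "smooth_fun_on n S (partial_deriv i f)"
  unfolding smooth_fun_on_def
proof (intro conjI allI impI)
  show "openin (Euclidean_space n) S" using assms(1) by (rule smooth_fun_on_openin)
  fix "is" assume "set is \<subseteq> {..<n}"
  then have "set (is @ [i]) \<subseteq> {..<n}" using assms(2) by auto
  then have *: "continuous_map (subtopology (Euclidean_space n) S) euclideanreal (iter_partial (is @ [i]) f) \<and>
     (\<forall>j<n. \<forall>z\<in>S. (\<lambda>t. iter_partial (is @ [i]) f (z(j := t))) field_differentiable (at (z j)))"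
    using assms(1) unfolding smooth_fun_on_def by blast
  show "continuous_map (subtopology (Euclidean_space n) S) euclideanreal (iter_partial is (partial_deriv i f))"
    using * by (simp add: iter_partial_snoc)
  show "\<forall>z\<in>S. (\<lambda>t. iter_partial is (partial_deriv i f) (z(j := t))) field_differentiable (at (z j))"
    if "j < n" for j
    using * that by (simp add: iter_partial_snoc)
qed

lemma smooth_fun_on_cong:
  assumes f: "smooth_fun_on n S f" and eq: "\<And>z. z \<in> S \<Longrightarrow> g z = f z"
  shows "smooth_fun_on n S g"
proof (rule smooth_fun_on_coinduct[where F = "{g. \<exists>f. smooth_fun_on n S f \<and> (\<forall>z\<in>S. g z = f z)}"])
  show S: "openin (Euclidean_space n) S" using f by (rule smooth_fun_on_openin)
  show "g \<in> {g. \<exists>f. smooth_fun_on n S f \<and> (\<forall>z\<in>S. g z = f z)}" using f eq by blast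
  fix g assume "g \<in> {g. \<exists>f. smooth_fun_on n S f \<and> (\<forall>z\<in>S. g z = f z)}"
  then obtain f where f: "smooth_fun_on n S f" "\<And>z. z \<in> S \<Longrightarrow> g z = f z" by blast
  show "continuous_map (subtopology (Euclidean_space n) S) euclideanreal g"
    by (rule continuous_map_eq[OF smooth_fun_on_continuous[OF f(1)]]) (use f in auto)
  fix i assume i: "i < n"
  show "(\<lambda>t. g (z(i := t))) field_differentiable (at (z i))" if "z \<in> S" for z
    using smooth_fun_on_partially_differentiable[OF f(1) i that]
      partially_differentiable_cong_on_openin[OF S i that, of g f] f(2) by blast
  have "partial_deriv i g z = partial_deriv i f z" if "z \<in> S" for z
    using partial_deriv_cong_on_openin[OF S i that f(2)] .
  then show "\<exists>h\<in>{g. \<exists>f. smooth_fun_on n S f \<and> (\<forall>z\<in>S. g z = f z)}. \<forall>z\<in>S. partial_deriv i g z = h z"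
    using smooth_fun_on_partial_deriv[OF f(1) i] by (intro bexI[of _ "partial_deriv i f"]) auto
qed

lemma smooth_fun_on_subset:
  assumes f: "smooth_fun_on n S f" and T: "openin (Euclidean_space n) T" "T \<subseteq> S"
  shows "smooth_fun_on n T f"
  unfolding smooth_fun_on_def
  using f T by (auto simp: smooth_fun_on_def intro: continuous_map_from_subtopology_mono)

text \<open>
  Differentiating a product \<open>f * g\<close> leads to \<open>f * \<partial>g + \<partial>f * g\<close>, so the products of smooth functions
  alone are not a family to which coinduction applies. The algebra generated by the smooth functions
  is closed under differentiation on \<open>S\<close>, and coinduction shows that it contains nothing new.
\<close>

inductive_set smooth_algebra :: "nat \<Rightarrow> (nat \<Rightarrow> real) set \<Rightarrow> ((nat \<Rightarrow> real) \<Rightarrow> real) set"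
  for n S where
  const: "(\<lambda>z. c) \<in> smooth_algebra n S"
| smooth: "smooth_fun_on n S f \<Longrightarrow> f \<in> smooth_algebra n S"
| add: "f \<in> smooth_algebra n S \<Longrightarrow> g \<in> smooth_algebra n S \<Longrightarrow> (\<lambda>z. f z + g z) \<in> smooth_algebra n S"
| mult: "f \<in> smooth_algebra n S \<Longrightarrow> g \<in> smooth_algebra n S \<Longrightarrow> (\<lambda>z. f z * g z) \<in> smooth_algebra n S"

lemma smooth_algebra_smooth:
  assumes S: "openin (Euclidean_space n) S" and f: "f \<in> smooth_algebra n S"
  shows "smooth_fun_on n S f"
proof (rule smooth_fun_on_coinduct[OF S f])
  show "continuous_map (subtopology (Euclidean_space n) S) euclideanreal f"
    if "f \<in> smooth_algebra n S" for f
    using that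
    by induction (auto intro: smooth_fun_on_continuous continuous_map_add continuous_map_real_mult)
  show diff: "(\<lambda>t. f (z(i := t))) field_differentiable (at (z i))"
    if "f \<in> smooth_algebra n S" "i < n" "z \<in> S" for f i z
    using that
    by induction (auto intro: smooth_fun_on_partially_differentiable field_differentiable_add
        field_differentiable_mult)
  show "\<exists>g\<in>smooth_algebra n S. \<forall>z\<in>S. partial_deriv i f z = g z"
    if "f \<in> smooth_algebra n S" and i: "i < n" for f i
    using that(1)
  proof induction
    case (const c)
    show ?case
      by (rule bexI[of _ "\<lambda>z. 0"]) (auto simp: partial_deriv_def intro: smooth_algebra.const)
  next
    case (smooth f)
    then show ?case
      using smooth_fun_on_partial_deriv[OF _ i] by (blast intro: smooth_algebra.smooth)
  next
    case (add f g)
    then obtain f' g' where "f' \<in> smooth_algebra n S" "g' \<in> smooth_algebra n S"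
      "\<forall>z\<in>S. partial_deriv i f z = f' z" "\<forall>z\<in>S. partial_deriv i g z = g' z" by blast
    moreover have "partial_deriv i (\<lambda>z. f z + g z) z = partial_deriv i f z + partial_deriv i g z"
      if "z \<in> S" for z
      using diff[OF add.hyps(1) i that] diff[OF add.hyps(2) i that]
      by (simp add: partial_deriv_def)
    ultimately show ?case
      by (intro bexI[of _ "\<lambda>z. f' z + g' z"]) (auto intro: smooth_algebra.add)
  next
    case (mult f g)
    then obtain f' g' where "f' \<in> smooth_algebra n S" "g' \<in> smooth_algebra n S"
      "\<forall>z\<in>S. partial_deriv i f z = f' z" "\<forall>z\<in>S. partial_deriv i g z = g' z" by blast
    moreover have "partial_deriv i (\<lambda>z. f z * g z) z = f z * partial_deriv i g z + partial_deriv i f z * g z"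
      if "z \<in> S" for z
      using diff[OF mult.hyps(1) i that] diff[OF mult.hyps(2) i that]
      by (simp add: partial_deriv_def)
    ultimately show ?case
      using mult.hyps
      by (intro bexI[of _ "\<lambda>z. f z * g' z + f' z * g z"])
        (auto intro: smooth_algebra.add smooth_algebra.mult)
  qed
qed

lemma smooth_fun_on_const:
  "openin (Euclidean_space n) S \<Longrightarrow> smooth_fun_on n S (\<lambda>z. c)"
  by (rule smooth_algebra_smooth) (auto intro: smooth_algebra.const)

lemma smooth_fun_on_add:
  "smooth_fun_on n S f \<Longrightarrow> smooth_fun_on n S g \<Longrightarrow> smooth_fun_on n S (\<lambda>z. f z + g z)"
  by (rule smooth_algebra_smooth) (auto intro: smooth_algebra.intros dest: smooth_fun_on_openin)

lemma smooth_fun_on_mult: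
  "smooth_fun_on n S f \<Longrightarrow> smooth_fun_on n S g \<Longrightarrow> smooth_fun_on n S (\<lambda>z. f z * g z)"
  by (rule smooth_algebra_smooth) (auto intro: smooth_algebra.intros dest: smooth_fun_on_openin)

lemma smooth_fun_on_sum:
  assumes "openin (Euclidean_space n) S" "\<And>i. i \<in> I \<Longrightarrow> smooth_fun_on n S (f i)"
  shows "smooth_fun_on n S (\<lambda>z. \<Sum>i\<in>I. f i z)"
  using assms by (induction I rule: infinite_finite_induct)
    (auto intro: smooth_fun_on_const smooth_fun_on_add)

definition append_coord :: "nat \<Rightarrow> (nat \<Rightarrow> real) \<Rightarrow> (nat \<Rightarrow> real) \<Rightarrow> nat \<Rightarrow> real" where
  "append_coord n z v = (\<lambda>i. if i < n then z i else v (i - n))"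

text \<open>
  Differentiating in one of the first \<open>n\<close> coordinates commutes with freezing the remaining ones, so the
  iterated derivatives of the slice are literally the slices of the iterated derivatives.
\<close>

lemma smooth_fun_on_slice:
  assumes f: "smooth_fun_on (n + r) S f" and T: "openin (Euclidean_space n) T"
    and v: "v \<in> topspace (Euclidean_space r)"
    and TS: "\<And>z. z \<in> T \<Longrightarrow> append_coord n z v \<in> S"
  shows "smooth_fun_on n T (\<lambda>z. f (append_coord n z v))"
proof -
  have upd: "append_coord n (z(i := t)) v = (append_coord n z v)(i := t)" if "i < n" for z i t
    using that by (auto simp: append_coord_def)
  have iter: "iter_partial is (\<lambda>z. f (append_coord n z v)) = (\<lambda>z. iter_partial is f (append_coord n z v))"
    if "set is \<subseteq> {..<n}" for "is"
    using that
  proof (induction "is")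
    case (Cons i js)
    then have "i < n" by simp
    moreover from this have "append_coord n z v i = z i" for z by (simp add: append_coord_def)
    ultimately show ?case
      using Cons by (simp add: partial_deriv_def upd)
  qed simp
  have "continuous_map (subtopology (Euclidean_space n) T)
          (subtopology (Euclidean_space (n + r)) S) (\<lambda>z. append_coord n z v)"
  proof -
    have "continuous_map (subtopology (Euclidean_space n) T) euclideanreal (\<lambda>z. z i)" for i
      unfolding Euclidean_space_def
      by (intro continuous_map_from_subtopology continuous_map_product_projection) simp
    then have "continuous_map (subtopology (Euclidean_space n) T) euclideanreal
         (\<lambda>z. append_coord n z v i)" for i
      by (cases "i < n") (simp_all add: append_coord_def)
    then show ?thesis
      using v TS
      unfolding continuous_map_in_subtopology Euclidean_space_def continuous_map_componentwise_UNIV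
      by (auto simp: append_coord_def topspace_Euclidean_space)
  qed
  note * = this
  have cont: "continuous_map (subtopology (Euclidean_space n) T) euclideanreal
       (\<lambda>z. iter_partial is f (append_coord n z v))" if "set is \<subseteq> {..<n}" for "is"
  proof -
    have "set is \<subseteq> {..<n + r}" using that by auto
    then have "continuous_map (subtopology (Euclidean_space (n + r)) S) euclideanreal (iter_partial is f)"
      using f by (simp add: smooth_fun_on_def)
    with * show ?thesis by (rule continuous_map_compose[unfolded o_def])
  qed
  show ?thesis
    unfolding smooth_fun_on_def
  proof (intro conjI allI impI ballI)
    fix "is" assume js: "set is \<subseteq> {..<n}"
    show "continuous_map (subtopology (Euclidean_space n) T) euclideanreal
       (iter_partial is (\<lambda>z. f (append_coord n z v)))"
      using cont[OF js] by (simp add: iter[OF js])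
    fix i z assume i: "i < n" and z: "z \<in> T"
    have "(\<lambda>t. iter_partial is f ((append_coord n z v)(i := t)))
            field_differentiable (at (append_coord n z v i))"
    proof -
      have "set is \<subseteq> {..<n + r}" "i < n + r" using js i by auto
      then show ?thesis using f TS[OF z] unfolding smooth_fun_on_def by blast
    qed
    then show "(\<lambda>t. iter_partial is (\<lambda>z. f (append_coord n z v)) (z(i := t)))
            field_differentiable (at (z i))"
      using i by (simp add: iter[OF js] upd) (simp add: append_coord_def)
  qed (rule T)
qed

section \<open>Sections of a smooth vector bundle\<close>

definition frame :: "('m, 'a) vbundle \<Rightarrow> ('a \<Rightarrow> nat \<Rightarrow> real) \<Rightarrow> nat \<Rightarrow> 'm \<Rightarrow> 'a" where
  "frame A \<phi> i p = inv_into (fibre A p) \<phi> (\<lambda>j. if j = i then 1 else 0)"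

text \<open>
  Linear functionals on sections that read off one coordinate at one point. They reduce equations
  between sections to equations between real numbers.
\<close>

definition coord_functionals :: "('m, 'a) vbundle \<Rightarrow> (('m \<Rightarrow> 'a) \<Rightarrow> real) set" where
  "coord_functionals A =
     {\<lambda>X. \<phi> (X p) l | P \<phi> p l. (P, \<phi>) \<in> btrivs A \<and> p \<in> bproj A ` P}"

locale vector_bundle =
  fixes A :: "('m::{t2_space,second_countable_topology},
               'a::{t2_space,second_countable_topology}) vbundle" (structure)
  assumes smooth_vector_bundle: "smooth_vector_bundle A"
begin

lemma bundle_conditions:
  shows base_atlas: "smooth_atlas (bdim A) (batlas A)"
    and "\<forall>p. bzero A p \<in> fibre A p"
    and "\<forall>p. \<forall>u\<in>fibre A p. \<forall>v\<in>fibre A p. badd A u v \<in> fibre A p"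
    and "\<forall>p c. \<forall>u\<in>fibre A p. bscale A c u \<in> fibre A p"
    and triv_cover: "(\<Union>(P, \<phi>)\<in>btrivs A. P) = UNIV"
  using smooth_vector_bundle unfolding smooth_vector_bundle_def by - (elim conjE, assumption)+

lemma zero_in_fibre: "bzero A p \<in> fibre A p"
  and add_in_fibre: "u \<in> fibre A p \<Longrightarrow> v \<in> fibre A p \<Longrightarrow> badd A u v \<in> fibre A p"
  and scale_in_fibre: "u \<in> fibre A p \<Longrightarrow> bscale A c u \<in> fibre A p"
  using bundle_conditions(2-4) by auto

lemma
  assumes "bundle_endomorphism A N"
  shows endomorphism_in_fibre: "u \<in> fibre A p \<Longrightarrow> N u \<in> fibre A p"
    and endomorphism_badd:
      "u \<in> fibre A p \<Longrightarrow> v \<in> fibre A p \<Longrightarrow> N (badd A u v) = badd A (N u) (N v)"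
    and endomorphism_bscale: "u \<in> fibre A p \<Longrightarrow> N (bscale A c u) = bscale A c (N u)"
  using assms by (auto simp: bundle_endomorphism_def fibre_def)

lemma ex_triv: "\<exists>(P, \<phi>)\<in>btrivs A. p \<in> bproj A ` P"
proof -
  have "bzero A p \<in> (\<Union>(P, \<phi>)\<in>btrivs A. P)"
    by (simp add: triv_cover)
  moreover have "bproj A (bzero A p) = p" using zero_in_fibre by (simp add: fibre_def)
  ultimately show ?thesis by (fastforce intro: rev_image_eqI)
qed

context
  fixes P \<phi>
  assumes triv: "(P, \<phi>) \<in> btrivs A"
begin

text \<open>
  Every fibre contains its zero vector, so the projection is onto and \<open>bproj A ` P\<close> is the open set of
  the base over which the trivialization \<open>\<phi>\<close> lives.
\<close>

lemma triv_conditions: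
  shows triv_base_open: "open (bproj A ` P)"
    and triv_domain: "e \<in> P \<longleftrightarrow> bproj A e \<in> bproj A ` P"
    and triv_fibres: "\<And>p. p \<in> bproj A ` P \<Longrightarrow>
       bij_betw \<phi> (fibre A p) (topspace (Euclidean_space (brank A))) \<and>
       \<phi> (bzero A p) = (\<lambda>i. 0) \<and>
       (\<forall>u\<in>fibre A p. \<forall>v\<in>fibre A p. \<phi> (badd A u v) = (\<lambda>i. \<phi> u i + \<phi> v i)) \<and>
       (\<forall>c. \<forall>u\<in>fibre A p. \<phi> (bscale A c u) = (\<lambda>i. c * \<phi> u i))"
proof -
  have "\<forall>(P, \<phi>)\<in>btrivs A. \<exists>V. open V \<and> P = bproj A -` V \<and>
      (\<forall>p\<in>V.
         bij_betw \<phi> (fibre A p) (topspace (Euclidean_space (brank A))) \<and>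
         \<phi> (bzero A p) = (\<lambda>i. 0) \<and>
         (\<forall>u\<in>fibre A p. \<forall>v\<in>fibre A p. \<phi> (badd A u v) = (\<lambda>i. \<phi> u i + \<phi> v i)) \<and>
         (\<forall>c. \<forall>u\<in>fibre A p. \<phi> (bscale A c u) = (\<lambda>i. c * \<phi> u i)))"
    using smooth_vector_bundle unfolding smooth_vector_bundle_def by - (elim conjE, assumption)
  from bspec[OF this triv] obtain V where V: "open V" "P = bproj A -` V"
    "\<forall>p\<in>V.
       bij_betw \<phi> (fibre A p) (topspace (Euclidean_space (brank A))) \<and>
       \<phi> (bzero A p) = (\<lambda>i. 0) \<and>
       (\<forall>u\<in>fibre A p. \<forall>v\<in>fibre A p. \<phi> (badd A u v) = (\<lambda>i. \<phi> u i + \<phi> v i)) \<and>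
       (\<forall>c. \<forall>u\<in>fibre A p. \<phi> (bscale A c u) = (\<lambda>i. c * \<phi> u i))"
    by auto
  have "surj (bproj A)"
    using zero_in_fibre unfolding fibre_def surj_def by (metis vimage_singleton_eq)
  then have PV: "bproj A ` P = V" using V(2) by (simp add: surj_image_vimage_eq)
  show "open (bproj A ` P)" using V(1) by (simp only: PV)
  show "e \<in> P \<longleftrightarrow> bproj A e \<in> bproj A ` P" unfolding PV using V(2) by blast
  show "bij_betw \<phi> (fibre A p) (topspace (Euclidean_space (brank A))) \<and>
       \<phi> (bzero A p) = (\<lambda>i. 0) \<and>
       (\<forall>u\<in>fibre A p. \<forall>v\<in>fibre A p. \<phi> (badd A u v) = (\<lambda>i. \<phi> u i + \<phi> v i)) \<and>
       (\<forall>c. \<forall>u\<in>fibre A p. \<phi> (bscale A c u) = (\<lambda>i. c * \<phi> u i))"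
    if "p \<in> bproj A ` P" for p
    using V(3) that unfolding PV by (rule bspec)
qed

context
  fixes p
  assumes p: "p \<in> bproj A ` P"
begin

lemma triv_bij: "bij_betw \<phi> (fibre A p) (topspace (Euclidean_space (brank A)))"
  and triv_zero: "\<phi> (bzero A p) = (\<lambda>i. 0)"
  and triv_add: "u \<in> fibre A p \<Longrightarrow> v \<in> fibre A p \<Longrightarrow> \<phi> (badd A u v) = (\<lambda>i. \<phi> u i + \<phi> v i)"
  and triv_scale: "u \<in> fibre A p \<Longrightarrow> \<phi> (bscale A c u) = (\<lambda>i. c * \<phi> u i)"
  using triv_fibres[OF p] by auto

lemma triv_inj: "u \<in> fibre A p \<Longrightarrow> v \<in> fibre A p \<Longrightarrow> \<phi> u = \<phi> v \<Longrightarrow> u = v"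
  using triv_bij by (auto simp: bij_betw_def dest: inj_onD)

lemma triv_vanishes: "u \<in> fibre A p \<Longrightarrow> i \<ge> brank A \<Longrightarrow> \<phi> u i = 0"
  using bij_betwE[OF triv_bij] by (auto simp: topspace_Euclidean_space)

lemma frame:
  assumes "i < brank A"
  shows frame_in_fibre: "frame A \<phi> i p \<in> fibre A p"
    and triv_frame: "\<phi> (frame A \<phi> i p) = (\<lambda>j. if j = i then 1 else 0)"
proof -
  have "(\<lambda>j. if j = i then 1 else 0) \<in> \<phi> ` fibre A p"
    using triv_bij assms by (auto simp: bij_betw_def topspace_Euclidean_space)
  then show "frame A \<phi> i p \<in> fibre A p" "\<phi> (frame A \<phi> i p) = (\<lambda>j. if j = i then 1 else 0)"
    unfolding frame_def by (rule inv_into_into, rule f_inv_into_f)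
qed

lemma triv_endomorphism:
  assumes N: "bundle_endomorphism A N" and e: "e \<in> fibre A p"
  shows "\<phi> (N e) l = (\<Sum>i<brank A. \<phi> e i * \<phi> (N (frame A \<phi> i p)) l)"
proof -
  note Nf = endomorphism_in_fibre[OF N] and Nadd = endomorphism_badd[OF N, where p = p]
    and Nscale = endomorphism_bscale[OF N, where p = p]
  \<comment> \<open>Induction on the number \<open>k\<close> of coordinates that may be nonzero; subtracting a multiple of
    the last frame vector kills coordinate \<open>k\<close>.\<close>
  have "\<phi> (N e) l = (\<Sum>i<k. \<phi> e i * \<phi> (N (frame A \<phi> i p)) l)"
    if "e \<in> fibre A p" "\<forall>i\<ge>k. \<phi> e i = 0" "k \<le> brank A" for e k
    using that
  proof (induction k arbitrary: e)
    case 0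
    \<comment> \<open>A vector with zero coordinates is \<open>0\<close> times itself, so homogeneity alone gives \<open>N e = 0\<close>.\<close>
    have "e = bscale A 0 e"
      using 0 by (intro triv_inj scale_in_fibre) (auto simp: triv_scale)
    then have "N e = bscale A 0 (N e)" using Nscale[OF 0(1), of 0] by simp
    then show ?case using triv_scale[OF Nf[OF 0(1)], of 0] by simp
  next
    case (Suc k)
    let ?f = "frame A \<phi> k p"
    have k: "k < brank A" using Suc.prems by simp
    note f = frame_in_fibre[OF k]
    define e' where "e' = badd A (bscale A (- \<phi> e k) ?f) e"
    have e': "e' \<in> fibre A p"
      unfolding e'_def by (intro add_in_fibre scale_in_fibre f Suc.prems)
    have co: "\<phi> e' = (\<lambda>j. if j = k then 0 else \<phi> e j)"
      unfolding e'_def using f Suc.prems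
      by (auto simp: triv_add triv_scale scale_in_fibre triv_frame[OF k])
    have "\<phi> (N e') l = - \<phi> e k * \<phi> (N ?f) l + \<phi> (N e) l"
      unfolding e'_def using f Suc.prems
      by (simp add: Nadd Nscale triv_add triv_scale scale_in_fibre Nf)
    moreover have "\<phi> (N e') l = (\<Sum>i<k. \<phi> e' i * \<phi> (N (frame A \<phi> i p)) l)"
      by (rule Suc.IH) (use e' co Suc.prems in auto)
    ultimately show ?case by (simp add: co)
  qed
  from this[of e "brank A"] show ?thesis using e triv_vanishes by simp
qed

end

end

lemma sec_zero_in_fibre: "sec_zero A p \<in> fibre A p"
  by (simp add: sec_zero_def zero_in_fibre)

lemma chart_conditions:
  assumes "(U, x) \<in> batlas A"
  shows chart_open: "open U"
    and chart_image_openin: "openin (Euclidean_space (bdim A)) (x ` U)"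
    and chart_homeomorphic:
      "homeomorphic_map (top_of_set U) (subtopology (Euclidean_space (bdim A)) (x ` U)) x"
  using bspec[OF base_atlas[unfolded smooth_atlas_def, THEN conjunct2, THEN conjunct1] assms]
  by auto

lemma chart_openin:
  assumes x: "(U, x) \<in> batlas A" and W: "open W" "W \<subseteq> U"
  shows "openin (Euclidean_space (bdim A)) (x ` W)"
proof -
  have "openin (top_of_set U) W" using W by (meson open_subset)
  then have "openin (subtopology (Euclidean_space (bdim A)) (x ` U)) (x ` W)"
    using homeomorphic_imp_open_map[OF chart_homeomorphic[OF x]] open_map_def by blast
  then show ?thesis using chart_image_openin[OF x] by (rule openin_trans_full)
qed

lemma chart_inj: "(U, x) \<in> batlas A \<Longrightarrow> inj_on x U"
  using homeomorphic_imp_injective_map[OF chart_homeomorphic] by fastforce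

lemma chart_vanishes:
  assumes "(U, x) \<in> batlas A" "p \<in> U" "i \<ge> bdim A"
  shows "x p i = 0"
  using openin_subset[OF chart_image_openin[OF assms(1)]] assms
  by (auto simp: topspace_Euclidean_space)

lemma trivialized_chart_openin:
  "(U, x) \<in> batlas A \<Longrightarrow> (P, \<phi>) \<in> btrivs A \<Longrightarrow>
     openin (Euclidean_space (bdim A)) (x ` (U \<inter> bproj A ` P))"
  by (intro chart_openin open_Int chart_open triv_base_open) auto

lemma smooth_mapD:
  assumes "smooth_map n atl m atl' F" "(U, x) \<in> atl" "(V, y) \<in> atl'" "j < m"
  shows "smooth_fun_on n (x ` (U \<inter> F -` V)) (\<lambda>z. y (F (inv_into U x z)) j)"
  using bspec[OF assms(1)[unfolded smooth_map_def] assms(2)] assms(3,4) by auto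

text \<open>
  In fibred coordinates a section is \<open>p \<mapsto> (x p, \<phi> (X p))\<close>. Its first block is a transition map between
  charts of the base, which is smooth by the atlas condition. So only the second block carries
  information, and the base chart of the target drops out of the criterion.
\<close>

lemma sections_iff_smooth_components:
  "X \<in> sections A \<longleftrightarrow>
     (\<forall>p. X p \<in> fibre A p) \<and>
     (\<forall>(U, x)\<in>batlas A. \<forall>(P, \<phi>)\<in>btrivs A. \<forall>l<brank A.
        smooth_fun_on (bdim A) (x ` (U \<inter> bproj A ` P)) (local_comp (U, x) \<phi> X l))"
  (is "_ \<longleftrightarrow> ?fib \<and> ?comp")
proof -
  have dom: "U \<inter> X -` (bproj A -` U' \<inter> P) = U \<inter> U' \<inter> bproj A ` P"
    if "?fib" "(P, \<phi>) \<in> btrivs A" for U U' P \<phi>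
  proof -
    have proj: "bproj A (X p) = p" for p using that(1) by (simp add: fibre_def)
    have "X p \<in> P \<longleftrightarrow> p \<in> bproj A ` P" for p
      using triv_domain[OF that(2), of "X p"] by (simp only: proj)
    then show ?thesis by (auto simp only: set_eq_iff Int_iff vimage_eq proj)
  qed
  show ?thesis
  proof (intro iffI conjI)
    assume X: "X \<in> sections A"
    then show fib: ?fib by (simp add: sections_def)
    have "smooth_fun_on (bdim A) (x ` (U \<inter> bproj A ` P)) (local_comp (U, x) \<phi> X l)"
      if x: "(U, x) \<in> batlas A" and \<phi>: "(P, \<phi>) \<in> btrivs A" and l: "l < brank A" for U x P \<phi> l
    proof -
      have "(bproj A -` U \<inter> P, fibred_coord A x \<phi>) \<in> total_atlas A"
        using x \<phi> by (auto simp: total_atlas_def)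
      moreover have "bdim A + l < bdim A + brank A" using l by simp
      ultimately have "smooth_fun_on (bdim A) (x ` (U \<inter> X -` (bproj A -` U \<inter> P)))
          (\<lambda>z. fibred_coord A x \<phi> (X (inv_into U x z)) (bdim A + l))"
        using X x by (intro smooth_mapD) (auto simp: sections_def)
      then show ?thesis
        unfolding dom[OF fib \<phi>] by (simp add: local_comp_def fibred_coord_def)
    qed
    then show ?comp by blast
  next
    assume "?fib \<and> ?comp"
    then have fib: ?fib and comp: ?comp by blast+
    have proj: "bproj A (X p) = p" for p using fib by (auto simp: fibre_def)
    have "openin (Euclidean_space (bdim A)) (x ` (U \<inter> X -` Q)) \<and>
          (\<forall>j<bdim A + brank A. smooth_fun_on (bdim A) (x ` (U \<inter> X -` Q))
             (\<lambda>z. y (X (inv_into U x z)) j))"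
      if x: "(U, x) \<in> batlas A" and y: "(Q, y) \<in> total_atlas A" for U x Q y
    proof -
      obtain U' x' P \<phi> where x': "(U', x') \<in> batlas A" and \<phi>: "(P, \<phi>) \<in> btrivs A"
        and Q: "Q = bproj A -` U' \<inter> P" and y: "y = fibred_coord A x' \<phi>"
        using y by (auto simp: total_atlas_def)
      let ?S = "x ` (U \<inter> U' \<inter> bproj A ` P)"
      have S: "openin (Euclidean_space (bdim A)) ?S"
        by (intro chart_openin[OF x] open_Int chart_open[OF x] chart_open[OF x']
            triv_base_open[OF \<phi>]) auto
      have "smooth_fun_on (bdim A) ?S (\<lambda>z. y (X (inv_into U x z)) j)"
        if j: "j < bdim A + brank A" for j
      proof (cases "j < bdim A")
        case True
        have "smooth_fun_on (bdim A) (x ` (U \<inter> id -` U')) (\<lambda>z. x' (id (inv_into U x z)) j)"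
          by (rule smooth_mapD[OF base_atlas[unfolded smooth_atlas_def, THEN conjunct2, THEN conjunct2]
                x x' True])
        then have "smooth_fun_on (bdim A) ?S (\<lambda>z. x' (inv_into U x z) j)"
          by (auto intro: smooth_fun_on_subset[OF _ S])
        then show ?thesis using True by (simp add: y fibred_coord_def proj)
      next
        case False
        then have "smooth_fun_on (bdim A) (x ` (U \<inter> bproj A ` P))
                     (local_comp (U, x) \<phi> X (j - bdim A))"
          using comp x \<phi> j by (fastforce simp: less_diff_conv2)
        then have "smooth_fun_on (bdim A) ?S (local_comp (U, x) \<phi> X (j - bdim A))"
          by (rule smooth_fun_on_subset[OF _ S]) blast
        then show ?thesis using False by (simp add: y fibred_coord_def local_comp_def)
      qed
      then show ?thesis using S unfolding Q dom[OF fib \<phi>] by blast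
    qed
    then show "X \<in> sections A" using fib unfolding sections_def smooth_map_def by blast
  qed
qed

lemma section_in_fibre: "X \<in> sections A \<Longrightarrow> X p \<in> fibre A p"
  by (simp add: sections_def)

lemma section_component_smooth:
  assumes "X \<in> sections A" "(U, x) \<in> batlas A" "(P, \<phi>) \<in> btrivs A" "l < brank A"
  shows "smooth_fun_on (bdim A) (x ` (U \<inter> bproj A ` P)) (local_comp (U, x) \<phi> X l)"
  using assms unfolding sections_iff_smooth_components by fast

lemma local_comp_at: "inv_into U x (x p) = p \<Longrightarrow> local_comp (U, x) \<phi> X l (x p) = \<phi> (X p) l"
  by (simp add: local_comp_def)

text \<open>
  The criterion with equality required only at chart points, where \<open>inv_into U x\<close> really inverts \<open>x\<close>.
\<close>

lemma sectionsI_components: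
  assumes fib: "\<And>p. Y p \<in> fibre A p"
    and smooth: "\<And>U x P \<phi> l. (U, x) \<in> batlas A \<Longrightarrow> (P, \<phi>) \<in> btrivs A \<Longrightarrow> l < brank A \<Longrightarrow>
        smooth_fun_on (bdim A) (x ` (U \<inter> bproj A ` P)) (f U x P \<phi> l)"
    and eq: "\<And>U x P \<phi> l p. (U, x) \<in> batlas A \<Longrightarrow> (P, \<phi>) \<in> btrivs A \<Longrightarrow> l < brank A \<Longrightarrow>
        p \<in> U \<Longrightarrow> p \<in> bproj A ` P \<Longrightarrow> inv_into U x (x p) = p \<Longrightarrow> \<phi> (Y p) l = f U x P \<phi> l (x p)"
  shows "Y \<in> sections A"
  unfolding sections_iff_smooth_components
proof (intro conjI allI ballI impI fib, clarify)
  fix U x P \<phi> l assume *: "(U, x) \<in> batlas A" "(P, \<phi>) \<in> btrivs A" "l < brank A"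
  show "smooth_fun_on (bdim A) (x ` (U \<inter> bproj A ` P)) (local_comp (U, x) \<phi> Y l)"
  proof (rule smooth_fun_on_cong[OF smooth[OF *]])
    fix z assume "z \<in> x ` (U \<inter> bproj A ` P)"
    then obtain p where p: "p \<in> U" "p \<in> bproj A ` P" "z = x p" by blast
    then have inv: "inv_into U x (x p) = p" using chart_inj[OF *(1)] by simp
    show "local_comp (U, x) \<phi> Y l z = f U x P \<phi> l z"
      using eq[OF * p(1,2) inv] by (simp add: local_comp_def p(3) inv)
  qed
qed

lemma sec_add_closed:
  assumes "X \<in> sections A" "Y \<in> sections A"
  shows "X \<oplus> Y \<in> sections A"
proof (rule sectionsI_components[where
      f = "\<lambda>U x P \<phi> l z. local_comp (U, x) \<phi> X l z + local_comp (U, x) \<phi> Y l z"])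
  show "(X \<oplus> Y) p \<in> fibre A p" for p
    using assms by (simp add: sec_add_def section_in_fibre add_in_fibre)
qed (use assms in \<open>simp_all add: smooth_fun_on_add section_component_smooth
      sec_add_def triv_add section_in_fibre local_comp_at\<close>)

lemma sec_scale_closed:
  assumes "X \<in> sections A"
  shows "c \<odot> X \<in> sections A"
proof (rule sectionsI_components[where f = "\<lambda>U x P \<phi> l z. c * local_comp (U, x) \<phi> X l z"])
  show "(c \<odot> X) p \<in> fibre A p" for p
    using assms by (simp add: sec_scale_def section_in_fibre scale_in_fibre)
qed (use assms in \<open>simp_all add: smooth_fun_on_mult smooth_fun_on_const trivialized_chart_openin
      section_component_smooth sec_scale_def triv_scale section_in_fibre local_comp_at
     \<close>)

lemma fibred_coord_eq_append_coord:
  "fibred_coord A x \<phi> e = append_coord (bdim A) (x (bproj A e)) (\<phi> e)"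
  by (auto simp: fibred_coord_def append_coord_def)

lemma fibred_coord_inj:
  assumes x: "(U, x) \<in> batlas A" and \<phi>: "(P, \<phi>) \<in> btrivs A"
  shows "inj_on (fibred_coord A x \<phi>) (bproj A -` U \<inter> P)"
proof (rule inj_onI)
  fix e e' assume e: "e \<in> bproj A -` U \<inter> P" and e': "e' \<in> bproj A -` U \<inter> P"
    and eq: "fibred_coord A x \<phi> e = fibred_coord A x \<phi> e'"
  have "x (bproj A e) i = x (bproj A e') i" for i
    using fun_cong[OF eq, of i] chart_vanishes[OF x, of _ i] e e'
    by (cases "i < bdim A") (simp_all add: fibred_coord_def)
  then have "x (bproj A e) = x (bproj A e')" by blast
  then have base: "bproj A e = bproj A e'"
    using chart_inj[OF x] e e' by (auto dest: inj_onD)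
  have "\<phi> e i = \<phi> e' i" for i
    using fun_cong[OF eq, of "bdim A + i"] by (simp add: fibred_coord_def)
  then have "\<phi> e = \<phi> e'" by blast
  moreover have "bproj A e \<in> bproj A ` P" using e by blast
  ultimately show "e = e'"
    using base by (intro triv_inj[OF \<phi>, of "bproj A e"]) (auto simp: fibre_def)
qed

text \<open>
  The frame vector \<open>i\<close> over the base point \<open>p\<close> has fibred coordinates \<open>(x p, e\<^sub>i)\<close> with \<open>e\<^sub>i\<close> the unit
  vector. So column \<open>i\<close> of the matrix of \<open>N\<close> is the fibre part of \<open>N\<close> in fibred coordinates,
  restricted to the slice \<open>v = e\<^sub>i\<close>.
\<close>

lemma endomorphism_matrix_smooth:
  assumes N: "bundle_endomorphism A N" and x: "(U, x) \<in> batlas A" and \<phi>: "(P, \<phi>) \<in> btrivs A"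
    and i: "i < brank A" and l: "l < brank A"
  shows "smooth_fun_on (bdim A) (x ` (U \<inter> bproj A ` P))
           (\<lambda>z. \<phi> (N (frame A \<phi> i (inv_into U x z))) l)"
proof -
  let ?Q = "bproj A -` U \<inter> P" and ?y = "fibred_coord A x \<phi>"
  let ?T = "x ` (U \<inter> bproj A ` P)" and ?v = "\<lambda>j. if j = i then 1 else 0 :: real"
  have y: "(?Q, ?y) \<in> total_atlas A" using x \<phi> by (auto simp: total_atlas_def)
  have proj: "bproj A (N e) = bproj A e" for e
    using N by (simp add: bundle_endomorphism_def)
  \<comment> \<open>\<open>N\<close> preserves fibres, so one fibred chart can serve as source and as target.\<close>
  have "N e \<in> P \<longleftrightarrow> e \<in> P" for e
    using triv_domain[OF \<phi>, of e] triv_domain[OF \<phi>, of "N e"] by (simp only: proj)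
  then have "N -` ?Q = ?Q"
    by (auto simp only: set_eq_iff Int_iff vimage_eq proj)
  moreover have "smooth_fun_on (bdim A + brank A) (?y ` (?Q \<inter> N -` ?Q))
      (\<lambda>w. ?y (N (inv_into ?Q ?y w)) (bdim A + l))"
    using N l by (intro smooth_mapD[OF _ y y]) (auto simp: bundle_endomorphism_def)
  ultimately have sm: "smooth_fun_on (bdim A + brank A) (?y ` ?Q)
      (\<lambda>w. \<phi> (N (inv_into ?Q ?y w)) l)"
    by (simp add: fibred_coord_def)
  have pt: "frame A \<phi> i p \<in> ?Q \<and> append_coord (bdim A) (x p) ?v = ?y (frame A \<phi> i p)"
    if "p \<in> U" "p \<in> bproj A ` P" for p
  proof -
    have "bproj A (frame A \<phi> i p) = p"
      using frame_in_fibre[OF \<phi> that(2) i] by (simp add: fibre_def)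
    moreover have "frame A \<phi> i p \<in> P"
      using triv_domain[OF \<phi>] calculation that by metis
    ultimately show ?thesis
      using that by (simp add: fibred_coord_eq_append_coord triv_frame[OF \<phi> that(2) i])
  qed
  have "smooth_fun_on (bdim A) ?T
          (\<lambda>z. \<phi> (N (inv_into ?Q ?y (append_coord (bdim A) z ?v))) l)"
    by (rule smooth_fun_on_slice[OF sm trivialized_chart_openin[OF x \<phi>]])
      (use i pt in \<open>auto simp: topspace_Euclidean_space\<close>)
  then show ?thesis
  proof (rule smooth_fun_on_cong)
    fix z assume "z \<in> ?T"
    then obtain p where p: "p \<in> U" "p \<in> bproj A ` P" "z = x p" by blast
    then have "inv_into U x z = p" using chart_inj[OF x] by simp
    then show "\<phi> (N (frame A \<phi> i (inv_into U x z))) l =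
        \<phi> (N (inv_into ?Q ?y (append_coord (bdim A) z ?v))) l"
      using pt[OF p(1,2)] fibred_coord_inj[OF x \<phi>] p(3) by simp
  qed
qed

lemma endomorphism_closed:
  assumes N: "bundle_endomorphism A N" and X: "X \<in> sections A"
  shows "N \<circ> X \<in> sections A"
proof (rule sectionsI_components[where f = "\<lambda>U x P \<phi> l z.
      \<Sum>i<brank A. local_comp (U, x) \<phi> X i z * \<phi> (N (frame A \<phi> i (inv_into U x z))) l"])
  show "(N \<circ> X) p \<in> fibre A p" for p
    by (simp add: endomorphism_in_fibre[OF N] section_in_fibre[OF X])
next
  fix U x P \<phi> l assume *: "(U, x) \<in> batlas A" "(P, \<phi>) \<in> btrivs A" "l < brank A"
  show "smooth_fun_on (bdim A) (x ` (U \<inter> bproj A ` P)) (\<lambda>z.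
      \<Sum>i<brank A. local_comp (U, x) \<phi> X i z * \<phi> (N (frame A \<phi> i (inv_into U x z))) l)"
    using * by (intro smooth_fun_on_sum smooth_fun_on_mult trivialized_chart_openin
        section_component_smooth[OF X] endomorphism_matrix_smooth[OF N]) simp_all
next
  fix U x P \<phi> l p
  assume "(U, x) \<in> batlas A" and \<phi>: "(P, \<phi>) \<in> btrivs A" and p: "p \<in> bproj A ` P"
    and inv: "inv_into U x (x p) = p"
  show "\<phi> ((N \<circ> X) p) l = (\<Sum>i<brank A. local_comp (U, x) \<phi> X i (x p) *
      \<phi> (N (frame A \<phi> i (inv_into U x (x p)))) l)"
    using triv_endomorphism[OF \<phi> p N section_in_fibre[OF X], of l]
    by (simp add: local_comp_def inv)
qed

lemma coord_functionalE:
  assumes "c \<in> coord_functionals A"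
  obtains P \<phi> p l where "c = (\<lambda>X. \<phi> (X p) l)" "(P, \<phi>) \<in> btrivs A" "p \<in> bproj A ` P"
  using assms unfolding coord_functionals_def by blast

lemma coord_functional_sec_add:
  "c \<in> coord_functionals A \<Longrightarrow> X \<in> sections A \<Longrightarrow> Y \<in> sections A \<Longrightarrow> c (X \<oplus> Y) = c X + c Y"
  by (elim coord_functionalE) (simp add: sec_add_def triv_add section_in_fibre)

lemma coord_functional_sec_scale:
  "c \<in> coord_functionals A \<Longrightarrow> X \<in> sections A \<Longrightarrow> c (a \<odot> X) = a * c X"
  by (elim coord_functionalE) (simp add: sec_scale_def triv_scale section_in_fibre)

lemma coord_functional_sec_zero: "c \<in> coord_functionals A \<Longrightarrow> c (sec_zero A) = 0"
  by (elim coord_functionalE) (simp add: sec_zero_def triv_zero)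

lemma coord_functionals_separate:
  assumes fib: "\<And>p. X p \<in> fibre A p" "\<And>p. Y p \<in> fibre A p"
    and eq: "\<And>c. c \<in> coord_functionals A \<Longrightarrow> c X = c Y"
  shows "X = Y"
proof
  fix p
  obtain P \<phi> where \<phi>: "(P, \<phi>) \<in> btrivs A" "p \<in> bproj A ` P" using ex_triv[of p] by blast
  have "\<phi> (X p) l = \<phi> (Y p) l" for l
    using eq[of "\<lambda>X. \<phi> (X p) l"] \<phi> by (auto simp: coord_functionals_def)
  then show "X p = Y p" using triv_inj[OF \<phi> fib] by blast
qed

end

section \<open>The contracted product and the torsion\<close>

locale leibniz_bundle = vector_bundle A for A (structure) +
  fixes prd (infixl "\<star>" 70) and N
  assumes leibniz: "leibniz_product A prd" and N: "bundle_endomorphism A N"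
begin

abbreviation contracted (infixl "\<star>\<^sub>N" 70) where
  "X \<star>\<^sub>N Y \<equiv> contracted_product A N prd X Y"

lemma prd_closed: "X \<in> sections A \<Longrightarrow> Y \<in> sections A \<Longrightarrow> X \<star> Y \<in> sections A"
  using leibniz unfolding leibniz_product_def bilinear_product_def by blast

lemmas closed = sec_add_closed sec_scale_closed endomorphism_closed[OF N] prd_closed

lemma prd_add:
  assumes "X \<in> sections A" "Y \<in> sections A" "Z \<in> sections A"
  shows "(X \<oplus> Y) \<star> Z = (X \<star> Z) \<oplus> (Y \<star> Z)" "X \<star> (Y \<oplus> Z) = (X \<star> Y) \<oplus> (X \<star> Z)"
  using leibniz assms unfolding leibniz_product_def bilinear_product_def by blast+

lemma prd_scale:
  assumes "X \<in> sections A" "Y \<in> sections A"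
  shows "(a \<odot> X) \<star> Y = a \<odot> (X \<star> Y)" "X \<star> (a \<odot> Y) = a \<odot> (X \<star> Y)"
  using leibniz assms unfolding leibniz_product_def bilinear_product_def by blast+

lemma prd_leibniz:
  assumes "X \<in> sections A" "Y \<in> sections A" "Z \<in> sections A"
  shows "(X \<star> Y) \<star> Z = (X \<star> (Y \<star> Z)) \<ominus> (Y \<star> (X \<star> Z))"
  using leibniz assms unfolding leibniz_product_def by blast

lemma endomorphism_sec_add:
  "X \<in> sections A \<Longrightarrow> Y \<in> sections A \<Longrightarrow> N \<circ> (X \<oplus> Y) = (N \<circ> X) \<oplus> (N \<circ> Y)"
  by (rule ext) (simp add: sec_add_def endomorphism_badd[OF N section_in_fibre section_in_fibre])

lemma endomorphism_sec_scale:
  "X \<in> sections A \<Longrightarrow> N \<circ> (a \<odot> X) = a \<odot> (N \<circ> X)"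
  by (rule ext) (simp add: sec_scale_def endomorphism_bscale[OF N section_in_fibre])

text \<open>
  Used as a rewrite rule from left to right, the Leibniz identity eliminates products whose left factor
  is itself a product. Together with linearity this gives a normal form: a coordinate functional of an
  expression becomes a real linear combination of its values on monomials in \<open>\<star>\<close> and \<open>N\<close> whose left
  factors are never products, and the identities below hold because the coefficients agree.
\<close>

lemmas expand = closed sec_diff_def prd_add prd_scale prd_leibniz
  endomorphism_sec_add endomorphism_sec_scale
  coord_functional_sec_add coord_functional_sec_scale

lemma contracted_closed: "X \<in> sections A \<Longrightarrow> Y \<in> sections A \<Longrightarrow> X \<star>\<^sub>N Y \<in> sections A"
  by (simp add: contracted_product_def sec_diff_def closed)

lemma torsion_closed:
  "X \<in> sections A \<Longrightarrow> Y \<in> sections A \<Longrightarrow> nijenhuis_torsion A N prd X Y \<in> sections A"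
  by (simp add: nijenhuis_torsion_def sec_diff_def closed contracted_closed)

lemma sections_eqI:
  "X \<in> sections A \<Longrightarrow> Y \<in> sections A \<Longrightarrow> (\<And>c. c \<in> coord_functionals A \<Longrightarrow> c X = c Y) \<Longrightarrow> X = Y"
  by (rule coord_functionals_separate) (auto simp: section_in_fibre)

lemma bilinear_contracted: "bilinear_product A (\<star>\<^sub>N)"
  unfolding bilinear_product_def
  by (intro conjI ballI allI contracted_closed; (intro sections_eqI)?;
      simp add: expand contracted_product_def algebra_simps)

text \<open>
  The cochain identity behind the theorem. Both sides have the same normal form; the cancellations
  that produce it are those for terms with $N$ on two arguments and those under an outer $N$.
\<close>

lemma delta_torsion_eq_leibniz_defect:
  assumes "c \<in> coord_functionals A" "X \<in> sections A" "Y \<in> sections A" "Z \<in> sections A"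
  shows "c (leibniz_delta A prd (nijenhuis_torsion A N prd) X Y Z) =
         c ((X \<star>\<^sub>N Y) \<star>\<^sub>N Z) - c ((X \<star>\<^sub>N (Y \<star>\<^sub>N Z)) \<ominus> (Y \<star>\<^sub>N (X \<star>\<^sub>N Z)))"
  using assms
  by (simp add: leibniz_delta_def nijenhuis_torsion_def contracted_product_def expand algebra_simps)

lemma leibniz_contracted_iff:
  "leibniz_product A (\<star>\<^sub>N) \<longleftrightarrow> leibniz_2_cocycle A prd (nijenhuis_torsion A N prd)"
proof -
  have "(X \<star>\<^sub>N Y) \<star>\<^sub>N Z = (X \<star>\<^sub>N (Y \<star>\<^sub>N Z)) \<ominus> (Y \<star>\<^sub>N (X \<star>\<^sub>N Z)) \<longleftrightarrow>
        leibniz_delta A prd (nijenhuis_torsion A N prd) X Y Z = sec_zero A"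
    (is "?L = ?R \<longleftrightarrow> ?D = _")
    if s: "X \<in> sections A" "Y \<in> sections A" "Z \<in> sections A" for X Y Z
  proof
    have D: "?D \<in> sections A"
      using s by (simp add: leibniz_delta_def sec_diff_def closed torsion_closed)
    have LR: "?L \<in> sections A" "?R \<in> sections A"
      using s by (simp_all add: sec_diff_def closed contracted_closed)
    show "?D = sec_zero A" if "?L = ?R"
      by (rule coord_functionals_separate)
        (use s D that in \<open>simp_all add: section_in_fibre sec_zero_in_fibre
           delta_torsion_eq_leibniz_defect coord_functional_sec_zero\<close>)
    show "?L = ?R" if "?D = sec_zero A"
      by (rule sections_eqI[OF LR])
        (use delta_torsion_eq_leibniz_defect[OF _ s] that in \<open>simp add: coord_functional_sec_zero\<close>)
  qed
  then show ?thesis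
    unfolding leibniz_product_def leibniz_2_cocycle_def using bilinear_contracted by simp
qed

lemma contracted_add:
  assumes "X \<in> sections A" "Y \<in> sections A" "Z \<in> sections A"
  shows "(X \<oplus> Y) \<star>\<^sub>N Z = (X \<star>\<^sub>N Z) \<oplus> (Y \<star>\<^sub>N Z)" "X \<star>\<^sub>N (Y \<oplus> Z) = (X \<star>\<^sub>N Y) \<oplus> (X \<star>\<^sub>N Z)"
  using bilinear_contracted assms unfolding bilinear_product_def by blast+

lemma contracted_scale:
  assumes "X \<in> sections A" "Y \<in> sections A"
  shows "(a \<odot> X) \<star>\<^sub>N Y = a \<odot> (X \<star>\<^sub>N Y)" "X \<star>\<^sub>N (a \<odot> Y) = a \<odot> (X \<star>\<^sub>N Y)"
  using bilinear_contracted assms unfolding bilinear_product_def by blast+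

text \<open>
  The part of the defect of $\star_N + a\,\star$ that is linear in $a$. It vanishes for every \<open>N\<close>,
  because \<open>\<star>\<^sub>N\<close> is a coboundary in the Leibniz cohomology of \<open>\<star>\<close> and hence a cocycle.
\<close>

lemma mixed_leibniz:
  assumes "c \<in> coord_functionals A" "X \<in> sections A" "Y \<in> sections A" "Z \<in> sections A"
  shows "c ((X \<star>\<^sub>N Y) \<star> Z) + c ((X \<star> Y) \<star>\<^sub>N Z) =
         c (X \<star>\<^sub>N (Y \<star> Z)) + c (X \<star> (Y \<star>\<^sub>N Z)) - c (Y \<star>\<^sub>N (X \<star> Z)) - c (Y \<star> (X \<star>\<^sub>N Z))"
  using assms by (simp add: contracted_product_def expand algebra_simps)

lemma pencil_leibniz:
  assumes L: "leibniz_product A (\<star>\<^sub>N)"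
  shows "leibniz_product A (\<lambda>X Y. (X \<star>\<^sub>N Y) \<oplus> (a \<odot> (X \<star> Y)))"
proof -
  note linear = closed contracted_closed sec_diff_def prd_add prd_scale contracted_add
    contracted_scale coord_functional_sec_add coord_functional_sec_scale
  have LN: "(X \<star>\<^sub>N Y) \<star>\<^sub>N Z = (X \<star>\<^sub>N (Y \<star>\<^sub>N Z)) \<ominus> (Y \<star>\<^sub>N (X \<star>\<^sub>N Z))"
    if "X \<in> sections A" "Y \<in> sections A" "Z \<in> sections A" for X Y Z
    using L that unfolding leibniz_product_def by blast
  let ?p = "\<lambda>X Y. (X \<star>\<^sub>N Y) \<oplus> (a \<odot> (X \<star> Y))"
  have "bilinear_product A ?p"
    unfolding bilinear_product_def
    by (intro conjI ballI allI; (intro sections_eqI)?; simp add: linear algebra_simps)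
  moreover have "?p (?p X Y) Z = ?p X (?p Y Z) \<ominus> ?p Y (?p X Z)"
    if s: "X \<in> sections A" "Y \<in> sections A" "Z \<in> sections A" for X Y Z
  proof (rule sections_eqI)
    fix c assume c: "c \<in> coord_functionals A"
    \<comment> \<open>Coefficients \<open>1\<close>, \<open>a\<close> and \<open>a\<^sup>2\<close> are handled by \<open>LN\<close>, by \<open>a\<close> times the mixed
      identity, and by the Leibniz identity of \<open>\<star>\<close>.\<close>
    show "c (?p (?p X Y) Z) = c (?p X (?p Y Z) \<ominus> ?p Y (?p X Z))"
      using s c arg_cong[OF mixed_leibniz[OF c s], of "(*) a"]
      by (simp add: linear LN prd_leibniz algebra_simps)
  qed (use s in \<open>simp_all add: linear\<close>)
  ultimately show ?thesis unfolding leibniz_product_def by blast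
qed

end

theorem theorem1:
  fixes A :: "('m::{t2_space,second_countable_topology},
               'a::{t2_space,second_countable_topology}) vbundle"
    and prd :: "('m \<Rightarrow> 'a) \<Rightarrow> ('m \<Rightarrow> 'a) \<Rightarrow> 'm \<Rightarrow> 'a"
    and N :: "'a \<Rightarrow> 'a"
  assumes "smooth_vector_bundle A"
    and "leibniz_product A prd"
    and "local_product A prd"
    and "bundle_endomorphism A N"
  shows "(leibniz_product A (contracted_product A N prd) \<longleftrightarrow>
            leibniz_2_cocycle A prd (nijenhuis_torsion A N prd)) \<and>
         (leibniz_product A (contracted_product A N prd) \<longrightarrow>
            compatible_leibniz_products A (contracted_product A N prd) prd)"
proof -
  interpret leibniz_bundle A prd N
    using assms by unfold_locales
  show ?thesis
    unfolding compatible_leibniz_products_def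
    using leibniz_contracted_iff pencil_leibniz assms(2) by blast
qed

end
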